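(* Let $\mu$ be a probability distribution on $\mathbb{N}$ such that the sequence $(\mu(n), n\ge 1)$ is non-increasing. Then, for any initial configuration $X_0\in\mathcal{S}$, the infinite-bin model $(X_n)_{n\ge 0}$ with reproduction law $\mu$ started from $X_0$ satisfies $$\mathbf{P}(X_\infty(k)<\infty)\in\{0,1\}\quad\text{for all } k\in\mathbb{Z}.$$
   Context: $\mathbb{N}=\{1,2,\ldots\}$ and $\mathbb{Z}_+=\{0,1,2,\ldots\}$. The set of configurations is $$\mathcal{S}=\Big\{X:\mathbb{Z}\to\mathbb{Z}_+\cup\{\infty\}\ :\ \sup\{j\in\mathbb{Z}: X(j)\neq 0\}\in(-\infty,\infty)\Big\};$$ $X(j)$ is the number of balls in the bin at position $j$ (so a configuration has at least one ball, and bins far enough to the right are empty). For $X\in\mathcal{S}$ and $k\in\mathbb{N}$, let $B(X,k)=\sup\{j\in\mathbb{Z}:\sum_{i=j}^\infty X(i)\ge k\}$ (location of the $k$th rightmost ball), with $\sup\emptyset=-\infty$. For $\xi\in\mathbb{N}$ define $\Phi_\xi:\mathcal{S}\to\mathcal{S}$ by $\Phi_\xi(X)(j)=X(j)+\mathbf{1}_{\{j=B(X,\xi)+1\}}$ for all $j\in\mathbb{Z}$ if $B(X,\xi)>-\infty$, and $\Phi_\xi(X)=X$ otherwise. Given a probability distribution $\mu$ on $\mathbb{N}$ and $X_0\in\mathcal{S}$ (deterministic), the infinite-bin model (IBM) with reproduction law $\mu$ started from $X_0$ is the process defined by $X_{n+1}=\Phi_{\xi_{n+1}}(X_n)$, $n\ge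 0$, where $(\xi_n)_{n\ge1}$ are i.i.d. with law $\mu$. Since $X_n(k)$ is non-decreasing in $n$, the limit $X_\infty(k)=\lim_{n\to\infty}X_n(k)\in\mathbb{Z}_+\cup\{\infty\}$ exists for every $k\in\mathbb{Z}$. *)

theory Defs
  imports "HOL-Probability.Probability"
begin

type_synonym config = "int \<Rightarrow> enat"

text \<open>Supremum of a set of integers in the extended reals, so that \<open>int_Sup {} = -\<infinity>\<close>.\<close>
definition int_Sup :: "int set \<Rightarrow> ereal" where
  "int_Sup A = (SUP j\<in>A. ereal (real_of_int j))"

definition configs :: "config set" where
  "configs = {X. int_Sup {j. X j \<noteq> 0} \<in> {-\<infinity><..<\<infinity>}}"

definition ball_pos :: "config \<Rightarrow> nat \<Rightarrow> ereal" where
  "ball_pos X k = int_Sup {j. (\<Sum>\<^sub>\<infinity>i\<in>{j..}. X i) \<ge> enat k}"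

text \<open>Only \<open>\<xi> \<ge> 1\<close> is meaningful; \<open>ibm_step 0\<close> is the identity because
  \<open>ball_pos X 0 = \<infinity>\<close>.\<close>
definition ibm_step :: "nat \<Rightarrow> config \<Rightarrow> config" where
  "ibm_step \<xi> X =
     (if ball_pos X \<xi> > -\<infinity>
      then (\<lambda>j. X j + (if ereal (real_of_int j) = ball_pos X \<xi> + 1 then 1 else 0))
      else X)"

text \<open>The driving sequence is used from index 1 on; \<open>\<xi> 0\<close> is ignored.\<close>
primrec ibm :: "config \<Rightarrow> (nat \<Rightarrow> nat) \<Rightarrow> nat \<Rightarrow> config" where
  "ibm X0 \<xi> 0 = X0"
| "ibm X0 \<xi> (Suc n) = ibm_step (\<xi> (Suc n)) (ibm X0 \<xi> n)"

definition ibm_limit :: "config \<Rightarrow> (nat \<Rightarrow> nat) \<Rightarrow> config" where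
  "ibm_limit X0 \<xi> k = lim (\<lambda>n. ibm X0 \<xi> n k)"

lemma int_Sup_real_iff:
  "int_Sup A \<in> {-\<infinity><..<\<infinity>} \<longleftrightarrow> A \<noteq> {} \<and> bdd_above A"
proof
  assume L: "int_Sup A \<in> {-\<infinity><..<\<infinity>}"
  have "A \<noteq> {}"
    using L by (auto simp: int_Sup_def bot_ereal_def)
  moreover obtain r where r: "int_Sup A = ereal r"
    using L by (cases "int_Sup A") auto
  have "j \<le> \<lfloor>r\<rfloor>" if "j \<in> A" for j
  proof -
    have "ereal (real_of_int j) \<le> int_Sup A"
      unfolding int_Sup_def using that by (intro SUP_upper)
    then show ?thesis using r by (simp add: le_floor_iff)
  qed
  then have "bdd_above A" by (rule bdd_aboveI)
  ultimately show "A \<noteq> {} \<and> bdd_above A" by blast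
next
  assume R: "A \<noteq> {} \<and> bdd_above A"
  then obtain a b where a: "a \<in> A" and b: "\<And>j. j \<in> A \<Longrightarrow> j \<le> b"
    by (auto simp: bdd_above_def)
  have "ereal (real_of_int a) \<le> int_Sup A"
    unfolding int_Sup_def using a by (intro SUP_upper)
  moreover have "int_Sup A \<le> ereal (real_of_int b)"
    unfolding int_Sup_def using b by (intro SUP_least) auto
  ultimately show "int_Sup A \<in> {-\<infinity><..<\<infinity>}"
    by (cases "int_Sup A") auto
qed

lemma configs_iff: "X \<in> configs \<longleftrightarrow> {j. X j \<noteq> 0} \<noteq> {} \<and> bdd_above {j. X j \<noteq> 0}"
  unfolding configs_def mem_Collect_eq by (rule int_Sup_real_iff)

lemma config_summable: "(X :: config) summable_on A"
  by (rule nonneg_summable_on_complete) simp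

lemma ibm_step_ge: "X k \<le> ibm_step \<xi> X k"
  by (auto simp: ibm_step_def)

lemma ibm_step_in_configs:
  assumes "X \<in> configs"
  shows "ibm_step \<xi> X \<in> configs"
proof -
  have sub: "{j. ibm_step \<xi> X j \<noteq> 0}
      \<subseteq> {j. X j \<noteq> 0} \<union> {j. ereal (real_of_int j) = ball_pos X \<xi> + 1}"
    by (auto simp: ibm_step_def split: if_splits)
  have "bdd_above {j. ereal (real_of_int j) = ball_pos X \<xi> + 1}"
  proof (cases "\<exists>a. ereal (real_of_int a) = ball_pos X \<xi> + 1")
    case True
    then obtain a where a: "ereal (real_of_int a) = ball_pos X \<xi> + 1" ..
    then have "{j. ereal (real_of_int j) = ball_pos X \<xi> + 1} = {a}"
      by (auto simp flip: a)
    then show ?thesis by simp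
  qed auto
  then have "bdd_above {j. ibm_step \<xi> X j \<noteq> 0}"
    using assms bdd_above_mono[OF _ sub] by (simp add: configs_iff)
  moreover have "{j. ibm_step \<xi> X j \<noteq> 0} \<noteq> {}"
  proof -
    obtain j where "X j \<noteq> 0" using assms by (auto simp: configs_iff)
    then have "ibm_step \<xi> X j \<noteq> 0" using ibm_step_ge[of X j \<xi>] by auto
    then show ?thesis by blast
  qed
  ultimately show ?thesis by (simp add: configs_iff)
qed

lemma ibm_in_configs: "X0 \<in> configs \<Longrightarrow> ibm X0 \<xi> n \<in> configs"
  by (induction n) (auto intro: ibm_step_in_configs)

lemma ibm_incseq: "incseq (\<lambda>n. ibm X0 \<xi> n k)"
  by (rule incseq_SucI) (simp add: ibm_step_ge)

lemma ibm_tendsto_limit: "(\<lambda>n. ibm X0 \<xi> n k) \<longlonglongrightarrow> ibm_limit X0 \<xi> k"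
  unfolding ibm_limit_def
  using LIMSEQ_SUP[OF ibm_incseq[of X0 \<xi> k]] convergent_LIMSEQ_iff convergentI by blast

lemma ibm_limit_eq_SUP: "ibm_limit X0 \<xi> k = (SUP n. ibm X0 \<xi> n k)"
  using LIMSEQ_SUP[OF ibm_incseq[of X0 \<xi> k]] ibm_tendsto_limit LIMSEQ_unique by blast

lemma ibm_limit_finite_iff:
  "ibm_limit X0 \<xi> k < \<infinity> \<longleftrightarrow> (\<exists>N. \<forall>n. ibm X0 \<xi> n k \<le> enat N)"
proof
  assume "ibm_limit X0 \<xi> k < \<infinity>"
  then obtain N where "(SUP n. ibm X0 \<xi> n k) = enat N"
    by (auto simp: ibm_limit_eq_SUP)
  then show "\<exists>N. \<forall>n. ibm X0 \<xi> n k \<le> enat N"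
    by (metis SUP_upper UNIV_I)
next
  assume "\<exists>N. \<forall>n. ibm X0 \<xi> n k \<le> enat N"
  then obtain N where "(SUP n. ibm X0 \<xi> n k) \<le> enat N"
    by (auto intro: SUP_least)
  then show "ibm_limit X0 \<xi> k < \<infinity>"
    by (cases "SUP n. ibm X0 \<xi> n k") (auto simp: ibm_limit_eq_SUP)
qed

lemma sets_ibm:
  assumes \<xi>: "\<And>n. n \<ge> 1 \<Longrightarrow> \<xi> n \<in> M \<rightarrow>\<^sub>M count_space UNIV"
  shows "{\<omega> \<in> space M. P (ibm X0 (\<lambda>i. \<xi> i \<omega>) n)} \<in> sets M"
proof (induction n arbitrary: P)
  case 0
  show ?case by simp
next
  case (Suc n)
  have [measurable]: "\<xi> (Suc n) \<in> M \<rightarrow>\<^sub>M count_space UNIV" by (rule \<xi>) simp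
  have "{\<omega> \<in> space M. P (ibm X0 (\<lambda>i. \<xi> i \<omega>) (Suc n))} =
    (\<Union>m. {\<omega> \<in> space M. \<xi> (Suc n) \<omega> = m}
        \<inter> {\<omega> \<in> space M. P (ibm_step m (ibm X0 (\<lambda>i. \<xi> i \<omega>) n))})"
    by auto
  also have "\<dots> \<in> sets M"
  proof (intro sets.countable_UN'' sets.Int)
    fix m
    show "{\<omega> \<in> space M. \<xi> (Suc n) \<omega> = m} \<in> sets M" by measurable
    show "{\<omega> \<in> space M. P (ibm_step m (ibm X0 (\<lambda>i. \<xi> i \<omega>) n))} \<in> sets M"
      by (rule Suc.IH)
  qed auto
  finally show ?case .
qed

lemma sets_ibm_limit_finite:
  assumes "\<And>n. n \<ge> 1 \<Longrightarrow> \<xi> n \<in> M \<rightarrow>\<^sub>M count_space UNIV"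
  shows "{\<omega> \<in> space M. ibm_limit X0 (\<lambda>n. \<xi> n \<omega>) k < \<infinity>} \<in> sets M"
proof -
  have [measurable]: "{\<omega> \<in> space M. ibm X0 (\<lambda>i. \<xi> i \<omega>) n k \<le> enat N} \<in> sets M" for n N
    using assms by (rule sets_ibm)
  show ?thesis unfolding ibm_limit_finite_iff by measurable
qed

end

theory Submission
  imports Defs
begin

text \<open>Write \<open>N\<^sub>n(k)\<close> for the number of balls at positions \<open>\<ge> k\<close> after \<open>n\<close> draws. A draw
  \<open>\<xi> \<ge> 1\<close> increases \<open>N(k)\<close> by one exactly when \<open>\<xi> \<le> N(k - 1)\<close>, so these counts are simpler to
  follow than the bins themselves.

  The idea is that the first draw cannot influence whether \<open>X\<^sub>\<infinity>(k)\<close> is finite. Run the model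
  with the same draws from a configuration \<open>X\<close> and from a configuration \<open>Y\<close> obtained from \<open>X\<close> by
  one step. The counts of \<open>Y\<close> exceed those of \<open>X\<close> by numbers \<open>D\<^sub>n(k)\<close> that start at
  \<open>0\<close> or \<open>1\<close> and can only grow: \<open>D(k)\<close> gains one when the draw falls into the interval
  \<open>(N(k - 1), N(k - 1) + D(k - 1)]\<close>. As \<open>\<mu>\<close> is non-increasing, this has conditional
  probability at most \<open>D\<^sub>n(k - 1) \<mu>(N\<^sub>n(k - 1) + 1)\<close>. Draws equal to \<open>1\<close> have positive
  probability and each of them increases \<open>N(k - 1)\<close>, apart from the finitely many needed to bring
  the front close to \<open>k - 1\<close>. Hence \<open>N\<^sub>n(k - 1)\<close> is at least of order \<open>n / q\<close> for some \<open>q\<close>, up to an event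
  whose probability is summable in \<open>n\<close> by Hoeffding's inequality. With
  \<open>s\<^sub>n\<close> the supremum of the expectations of \<open>D\<^sub>n(k)\<close> over all \<open>k \<le> K\<close> this gives
  \<open>s\<^bsub>n+1\<^esub> \<le> (1 + a\<^sub>n) s\<^sub>n + e\<^sub>n\<close>, where \<open>a\<^sub>n = \<mu>(n div q + 1)\<close> and \<open>e\<^sub>n\<close> are both
  summable. Taking the supremum over all positions left of \<open>K\<close> removes the need for a leftmost
  position at which an induction on \<open>k\<close> could start. So the expectations stay bounded, and
  by monotone convergence \<open>D\<^sub>n(k)\<close> is almost surely bounded in \<open>n\<close>
  (\<open>AE_excess_bounded\<close>). A bounded excess changes every bin by a bounded number of balls, hence
  \<open>X\<^sub>\<infinity>(k)\<close> and \<open>Y\<^sub>\<infinity>(k)\<close> are almost surely both finite or both infinite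
  (\<open>AE_limit_finite_step_iff\<close>).

  Let \<open>E\<^sub>m\<close> be the event that the model started from \<open>X\<^sub>0\<close> and driven by
  \<open>\<xi>\<^bsub>m+1\<^esub>, \<xi>\<^bsub>m+2\<^esub>, \<dots>\<close> has a finite limit at \<open>k\<close>. The comparison shows that \<open>E\<^sub>m\<close> and
  \<open>E\<^bsub>m+1\<^esub>\<close> agree up to a null set for every \<open>m\<close>, so \<open>E\<^sub>0\<close> agrees almost surely with the limit
  superior of the \<open>E\<^sub>m\<close>. The latter is a tail event of independent variables, and Kolmogorov's
  zero-one law applies.\<close>

section \<open>Balls at or to the right of a position\<close>

definition balls_from :: "config \<Rightarrow> int \<Rightarrow> enat" where
  "balls_from X k = (\<Sum>\<^sub>\<infinity>i\<in>{k..}. X i)"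

lemma balls_from_split: "balls_from X k = X k + balls_from X (k + 1)"
proof -
  have "infsum X ({k} \<union> {k + 1..}) = infsum X {k} + infsum X {k + 1..}"
    by (rule infsum_Un_disjoint) (auto simp: config_summable)
  moreover have "{k} \<union> {k + 1..} = {k..}" by auto
  ultimately show ?thesis
    unfolding balls_from_def by simp
qed

lemma balls_from_antimono: "k \<le> l \<Longrightarrow> balls_from X l \<le> balls_from X k"
  unfolding balls_from_def by (rule infsum_mono_neutral) (auto simp: config_summable)

lemma balls_from_mono: "(\<And>i. X i \<le> Y i) \<Longrightarrow> balls_from X k \<le> balls_from Y k"
  unfolding balls_from_def by (rule infsum_mono) (auto simp: config_summable)

lemma balls_from_eventually_0:
  assumes "X \<in> configs"
  obtains b where "\<And>k. k > b \<Longrightarrow> balls_from X k = 0"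
proof -
  obtain b where b: "\<And>j. X j \<noteq> 0 \<Longrightarrow> j \<le> b"
    using assms by (auto simp: configs_iff bdd_above_def)
  have "balls_from X k = 0" if "k > b" for k
    unfolding balls_from_def by (rule infsum_0) (use b that in force)
  then show thesis by (rule that)
qed

lemma int_Sup_greatest:
  assumes "m \<in> A" "\<And>j. j \<in> A \<Longrightarrow> j \<le> m"
  shows "int_Sup A = ereal (real_of_int m)"
  unfolding int_Sup_def
  by (rule antisym) (use assms in \<open>auto intro!: SUP_least SUP_upper\<close>)

text \<open>The receiving bin \<open>k\<close> is the leftmost position with fewer than \<open>x\<close> balls at or to the right
  of it. This turns the supremum in the definition of the ball position into inequalities between
  ball counts, and it covers the degenerate cases \<open>x = 0\<close> and a supremum of \<open>-\<infinity>\<close>, in which no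
  position satisfies the right-hand side.\<close>
lemma ball_pos_succ_iff:
  assumes "X \<in> configs"
  shows "ereal (real_of_int k) = ball_pos X x + 1 \<longleftrightarrow> balls_from X k < enat x \<and> enat x \<le> balls_from X (k - 1)"
proof -
  let ?A = "{j. enat x \<le> balls_from X j}"
  have pos: "ball_pos X x = int_Sup ?A"
    unfolding ball_pos_def balls_from_def ..
  show ?thesis
  proof
    assume R: "balls_from X k < enat x \<and> enat x \<le> balls_from X (k - 1)"
    have "j \<le> k - 1" if "j \<in> ?A" for j
    proof (rule ccontr)
      assume "\<not> j \<le> k - 1"
      then have "balls_from X j \<le> balls_from X k" by (intro balls_from_antimono) auto
      then show False using R that by auto
    qed
    then have "ball_pos X x = ereal (real_of_int (k - 1))"
      unfolding pos by (intro int_Sup_greatest) (use R in auto)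
    then show "ereal (real_of_int k) = ball_pos X x + 1"
      by (simp add: one_ereal_def)
  next
    assume L: "ereal (real_of_int k) = ball_pos X x + 1"
    then have "int_Sup ?A \<in> {-\<infinity><..<\<infinity>}"
      unfolding pos[symmetric] by (cases "ball_pos X x") auto
    then have A: "?A \<noteq> {}" "bdd_above ?A" using int_Sup_real_iff[of ?A] by metis+
    \<comment> \<open>A non-empty set of integers that is bounded above has a greatest element.\<close>
    obtain m where m: "m \<in> ?A" "Sup ?A - 1 < m"
      using less_cSupE[of "Sup ?A - 1" ?A] A by auto
    have max: "j \<le> m" if "j \<in> ?A" for j
      using cSup_upper[OF that A(2)] m(2) by linarith
    have "k = m + 1"
      using L int_Sup_greatest[of m ?A, OF m(1) max] unfolding pos
      by (simp add: one_ereal_def)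
    moreover have "m + 1 \<notin> ?A" using max[of "m + 1"] by auto
    ultimately show "balls_from X k < enat x \<and> enat x \<le> balls_from X (k - 1)"
      using m(1) by (auto simp: not_le)
  qed
qed

lemma ibm_step_eq:
  assumes "X \<in> configs"
  shows "ibm_step x X j =
    X j + (if balls_from X j < enat x \<and> enat x \<le> balls_from X (j - 1) then 1 else 0)"
  unfolding ibm_step_def ball_pos_succ_iff[OF assms, symmetric] by auto

text \<open>The new ball lands at or to the right of \<open>k\<close> iff its parent is at or to the right of
  \<open>k - 1\<close>. The proof goes leftwards from a position beyond all balls, adding one bin at a time.\<close>
lemma balls_from_ibm_step:
  assumes X: "X \<in> configs"
  shows "balls_from (ibm_step x X) k =
    balls_from X k + (if 1 \<le> x \<and> enat x \<le> balls_from X (k - 1) then 1 else 0)"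
proof -
  obtain b where b: "\<And>k. k > b \<Longrightarrow> balls_from X k = 0"
    using balls_from_eventually_0[OF X] by blast
  have far: "balls_from (ibm_step x X) k = balls_from X k
      + (if 1 \<le> x \<and> enat x \<le> balls_from X (k - 1) then 1 else 0)" if "k \<ge> b + 2" for k
  proof -
    have "ibm_step x X i = 0" if "i \<ge> k" for i
    proof -
      have "balls_from X i = 0" "balls_from X (i - 1) = 0"
        using that \<open>k \<ge> b + 2\<close> by (auto intro!: b)
      moreover from this have "X i = 0" using balls_from_split[of X i] by simp
      ultimately show ?thesis by (auto simp: ibm_step_eq[OF X])
    qed
    then have "balls_from (ibm_step x X) k = 0"
      unfolding balls_from_def by (intro infsum_0) auto
    moreover have "balls_from X k = 0" "balls_from X (k - 1) = 0"
      using that by (auto intro!: b)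
    ultimately show ?thesis by (simp add: enat_0_iff)
  qed
  show ?thesis
  proof (cases "k \<ge> b + 2")
    case True
    then show ?thesis by (rule far)
  next
    case False
    then have "k \<le> b + 2" by simp
    then show ?thesis
    proof (induction k rule: int_le_induct)
      case base
      show ?case by (rule far) simp
    next
      case (step i)
      have mono: "balls_from X i \<le> balls_from X (i - 1)" "balls_from X (i - 1) \<le> balls_from X (i - 1 - 1)"
        by (auto intro: balls_from_antimono)
      have "balls_from (ibm_step x X) (i - 1) = ibm_step x X (i - 1) + balls_from (ibm_step x X) i"
        using balls_from_split[of _ "i - 1"] by simp
      also have "\<dots> = (X (i - 1) + balls_from X i)
        + ((if balls_from X (i - 1) < enat x \<and> enat x \<le> balls_from X (i - 1 - 1) then 1 else 0)
          + (if 1 \<le> x \<and> enat x \<le> balls_from X (i - 1) then 1 else 0))"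
        unfolding step.IH ibm_step_eq[OF X] by (simp add: ac_simps)
      also have "X (i - 1) + balls_from X i = balls_from X (i - 1)"
        using balls_from_split[of X "i - 1"] by simp
      also have "(if balls_from X (i - 1) < enat x \<and> enat x \<le> balls_from X (i - 1 - 1) then 1 else 0)
          + (if 1 \<le> x \<and> enat x \<le> balls_from X (i - 1) then 1 else 0)
          = (if 1 \<le> x \<and> enat x \<le> balls_from X (i - 1 - 1) then 1 else (0::enat))"
        using mono by (cases x) (auto simp: zero_enat_def[symmetric] not_less not_le)
      finally show ?case .
    qed
  qed
qed

section \<open>Two configurations driven by the same draws\<close>

text \<open>The number of additional balls at or to the right of \<open>k\<close> when the model is started from a
  configuration whose ball counts exceed those of \<open>X\<close> by \<open>d\<close>. It is defined without
  subtracting counts, because these may be infinite.\<close>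
primrec excess :: "config \<Rightarrow> (int \<Rightarrow> nat) \<Rightarrow> (nat \<Rightarrow> nat) \<Rightarrow> nat \<Rightarrow> int \<Rightarrow> nat" where
  "excess X d \<xi> 0 k = d k"
| "excess X d \<xi> (Suc n) k = excess X d \<xi> n k +
    (let a = balls_from (ibm X \<xi> n) (k - 1) in
      if a < enat (\<xi> (Suc n)) \<and> enat (\<xi> (Suc n)) \<le> a + enat (excess X d \<xi> n (k - 1)) then 1 else 0)"

text \<open>A draw increases the larger count but not the smaller one precisely when it lies between the two
  counts at \<open>k - 1\<close>.\<close>
lemma balls_from_excess:
  assumes "X \<in> configs" "Y \<in> configs" "\<And>k. balls_from Y k = balls_from X k + enat (d k)"
  shows "balls_from (ibm Y \<xi> n) k = balls_from (ibm X \<xi> n) k + enat (excess X d \<xi> n k)"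
proof (induction n arbitrary: k)
  case 0
  show ?case by (simp add: assms)
next
  case (Suc n)
  let ?a = "balls_from (ibm X \<xi> n) (k - 1)" and ?e = "enat (excess X d \<xi> n (k - 1))"
    and ?x = "\<xi> (Suc n)"
  have "(if 1 \<le> ?x \<and> enat ?x \<le> ?a + ?e then 1 else 0) =
    (if 1 \<le> ?x \<and> enat ?x \<le> ?a then 1 else 0) +
    (if ?a < enat ?x \<and> enat ?x \<le> ?a + ?e then 1 else (0::enat))"
    by (cases ?a) auto
  then show ?case
    unfolding ibm.simps balls_from_ibm_step[OF ibm_in_configs[OF assms(1)]]
      balls_from_ibm_step[OF ibm_in_configs[OF assms(2)]] Suc.IH excess.simps Let_def
    by (simp add: add_ac one_enat_def)
qed

lemma excess_mono: "incseq (\<lambda>n. excess X d \<xi> n k)"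
  by (rule incseq_SucI) simp

lemma balls_from_mono_time:
  "m \<le> n \<Longrightarrow> balls_from (ibm X \<xi> m) k \<le> balls_from (ibm X \<xi> n) k"
  by (intro balls_from_mono incseqD[OF ibm_incseq])

lemma balls_from_ibm_finite:
  assumes "X \<in> configs" "balls_from X k < \<infinity>"
  shows "balls_from (ibm X \<xi> n) k < \<infinity>"
proof (induction n)
  case (Suc n)
  then show ?case
    by (auto simp: balls_from_ibm_step[OF ibm_in_configs[OF assms(1)]] one_enat_def)
qed (use assms in simp)

text \<open>With infinitely many balls at or to the right of \<open>k\<close>, every ball that can be drawn sits there,
  and its child is placed strictly to the right of \<open>k\<close>.\<close>
lemma ibm_const_of_balls_from_infinite:
  assumes "X \<in> configs" "balls_from X k = \<infinity>"
  shows "ibm X \<xi> n k = X k"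
proof (induction n)
  case (Suc n)
  have "balls_from (ibm X \<xi> n) k = \<infinity>"
    using balls_from_mono_time[of 0 n X \<xi> k] assms(2) by simp
  then show ?case
    using Suc.IH by (simp add: ibm_step_eq[OF ibm_in_configs[OF assms(1)]])
qed simp

text \<open>The content of bin \<open>k\<close> is the difference of the counts at \<open>k\<close> and \<open>k + 1\<close>. Both sides carry
  added terms to avoid this subtraction; finiteness of the counts lets the common count at
  \<open>k + 1\<close> cancel.\<close>
lemma ibm_excess_eq:
  assumes "X \<in> configs" "Y \<in> configs" "\<And>k. balls_from Y k = balls_from X k + enat (d k)"
    "balls_from X k < \<infinity>"
  shows "ibm Y \<xi> n k + enat (excess X d \<xi> n (k + 1)) = ibm X \<xi> n k + enat (excess X d \<xi> n k)"
proof -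
  obtain t where t: "balls_from (ibm X \<xi> n) (k + 1) = enat t"
    using balls_from_ibm_finite[OF assms(1,4), of \<xi> n] balls_from_antimono[of k "k + 1" "ibm X \<xi> n"]
    by (cases "balls_from (ibm X \<xi> n) (k + 1)") auto
  have "ibm Y \<xi> n k + (enat t + enat (excess X d \<xi> n (k + 1)))
      = (ibm X \<xi> n k + enat t) + enat (excess X d \<xi> n k)"
    using balls_from_split[of "ibm Y \<xi> n" k] balls_from_split[of "ibm X \<xi> n" k]
      balls_from_excess[OF assms(1-3), of \<xi> n k] balls_from_excess[OF assms(1-3), of \<xi> n "k + 1"] t
    by metis
  then show ?thesis by (cases "ibm X \<xi> n k"; cases "ibm Y \<xi> n k") auto
qed

lemma ibm_cong: "(\<And>i. i \<in> {1..n} \<Longrightarrow> x i = y i) \<Longrightarrow> ibm X x n = ibm X y n"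
  by (induction n) auto

lemma excess_cong: "(\<And>i. i \<in> {1..n} \<Longrightarrow> x i = y i) \<Longrightarrow> excess X d x n k = excess X d y n k"
proof (induction n arbitrary: k)
  case (Suc n)
  then have "excess X d x n k = excess X d y n k" for k by simp
  moreover have "ibm X x n = ibm X y n" by (rule ibm_cong) (simp add: Suc.prems)
  ultimately show ?case using Suc.prems[of "Suc n"] by (simp add: Let_def)
qed simp

text \<open>If the count at \<open>k\<close> is finite, the contents of bin \<open>k\<close> differ by a bounded amount at all times.
  If it is infinite, bin \<open>k\<close> never changes, and the initial contents decide.\<close>
lemma limit_finite_iff_of_bounded_excess:
  assumes "X \<in> configs" "Y \<in> configs" "\<And>k. balls_from Y k = balls_from X k + enat (d k)"
    and inf: "X k = \<infinity> \<longleftrightarrow> Y k = \<infinity>"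
    and bounded: "\<And>k. \<exists>B. \<forall>n. excess X d \<xi> n k \<le> B"
  shows "ibm_limit Y \<xi> k < \<infinity> \<longleftrightarrow> ibm_limit X \<xi> k < \<infinity>"
proof (cases "balls_from X k < \<infinity>")
  case True
  note eq = ibm_excess_eq[OF assms(1-3) True, of \<xi>]
  obtain B B' where B: "\<And>n. excess X d \<xi> n k \<le> B" and B': "\<And>n. excess X d \<xi> n (k + 1) \<le> B'"
    using bounded by metis
  have "ibm Y \<xi> n k \<le> enat (N + B)" if "ibm X \<xi> n k \<le> enat N" for n N
    using eq[of n] B[of n] that by (cases "ibm X \<xi> n k"; cases "ibm Y \<xi> n k") auto
  moreover have "ibm X \<xi> n k \<le> enat (N + B')" if "ibm Y \<xi> n k \<le> enat N" for n N
    using eq[of n] B'[of n] that by (cases "ibm X \<xi> n k"; cases "ibm Y \<xi> n k") auto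
  ultimately show ?thesis unfolding ibm_limit_finite_iff by meson
next
  case False
  then have X: "balls_from X k = \<infinity>" and Y: "balls_from Y k = \<infinity>" using assms(3)[of k] by auto
  show ?thesis
    using inf by (simp add: ibm_limit_eq_SUP ibm_const_of_balls_from_infinite[OF assms(1) X]
        ibm_const_of_balls_from_infinite[OF assms(2) Y])
qed

section \<open>Linear growth of the number of balls\<close>

text \<open>Draws equal to \<open>1\<close> serve as a clock: such a draw reproduces the rightmost ball and so pushes the
  front forward, whatever the configuration.\<close>
definition ones :: "(nat \<Rightarrow> nat) \<Rightarrow> nat \<Rightarrow> nat" where
  "ones \<xi> n = card {i \<in> {1..n}. \<xi> i = 1}"

lemma ones_0 [simp]: "ones \<xi> 0 = 0"
  by (simp add: ones_def)

lemma ones_Suc: "ones \<xi> (Suc n) = ones \<xi> n + (if \<xi> (Suc n) = 1 then 1 else 0)"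
proof -
  have "{i \<in> {1..Suc n}. \<xi> i = 1} =
      {i \<in> {1..n}. \<xi> i = 1} \<union> (if \<xi> (Suc n) = 1 then {Suc n} else {})"
    by (auto simp: le_Suc_eq)
  then show ?thesis unfolding ones_def by (simp add: card_Un_disjoint)
qed

lemma ones_cong: "(\<And>i. i \<in> {1..n} \<Longrightarrow> x i = y i) \<Longrightarrow> ones x n = ones y n"
  unfolding ones_def by (rule arg_cong[where f = card]) auto

text \<open>Once there is a ball at or to the right of \<open>j + i - 1\<close>, each draw equal to \<open>1\<close> increases the
  count at \<open>j + i\<close>. Starting from a ball at or to the right of \<open>j\<close>, at most \<open>i\<close> draws
  equal to \<open>1\<close> are spent before that happens.\<close>
lemma ones_le_balls_from_offset:
  assumes "X \<in> configs" "balls_from X j \<ge> 1"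
  shows "enat (ones \<xi> n) \<le> balls_from (ibm X \<xi> n) (j + int i) + enat i"
proof (induction n arbitrary: i)
  case 0
  then show ?case by (simp add: zero_enat_def[symmetric])
next
  case (Suc n)
  let ?N = "\<lambda>i. balls_from (ibm X \<xi> n) (j + int i)"
  have conf: "ibm X \<xi> n \<in> configs" by (rule ibm_in_configs) fact
  \<comment> \<open>Either the next one counts at position \<open>j + i\<close>, or the allowance \<open>i\<close> still covers it.\<close>
  have prev: "balls_from (ibm X \<xi> n) (j + int i - 1) \<ge> 1 \<or> (i \<ge> 1 \<and> ones \<xi> n < i)"
  proof (cases i)
    case 0
    have "1 \<le> balls_from X j" by fact
    also have "\<dots> \<le> balls_from (ibm X \<xi> n) j" using balls_from_mono_time[of 0 n X \<xi> j] by simp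
    also have "\<dots> \<le> balls_from (ibm X \<xi> n) (j - 1)" by (rule balls_from_antimono) simp
    finally show ?thesis using 0 by simp
  next
    case (Suc i')
    then show ?thesis using Suc.IH[of i']
      by (cases "?N i'") (auto simp: one_enat_def)
  qed
  show ?case
    using prev Suc.IH[of i]
    by (cases "?N i") (auto simp: balls_from_ibm_step[OF conf] ones_Suc one_enat_def zero_enat_def[symmetric])
qed

text \<open>The constant is uniform over all positions up to \<open>K\<close> because counts only increase to the left.\<close>
lemma ones_le_balls_from:
  assumes X: "X \<in> configs"
  obtains C where "\<And>\<xi> n k. k \<le> K \<Longrightarrow> enat (ones \<xi> n) \<le> balls_from (ibm X \<xi> n) k + enat C"
proof -
  obtain j where "X j \<noteq> 0" using X by (auto simp: configs_iff)
  then have j: "balls_from X j \<ge> 1"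
    using balls_from_split[of X j] by (auto simp: one_eSuc ileI1 iless_eSuc0 Suc_ile_eq not_less)
  have "enat (ones \<xi> n) \<le> balls_from (ibm X \<xi> n) k + enat (nat (K - j))" if "k \<le> K" for \<xi> n k
  proof -
    have "balls_from (ibm X \<xi> n) (j + int (nat (K - j))) \<le> balls_from (ibm X \<xi> n) k"
      using that by (intro balls_from_antimono) auto
    then show ?thesis
      using ones_le_balls_from_offset[OF X j, of \<xi> n "nat (K - j)"]
      by (meson add_right_mono order_trans)
  qed
  then show thesis by (rule that)
qed

section \<open>Reproduction laws with non-increasing weights\<close>

lemma pmf_1_pos:
  assumes supp: "set_pmf \<mu> \<subseteq> {1..}" and anti: "antimono_on {1..} (pmf \<mu>)"
  shows "pmf \<mu> (1::nat) > 0"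
proof -
  obtain i where i: "i \<in> set_pmf \<mu>" using set_pmf_not_empty[of \<mu>] by blast
  then have "pmf \<mu> i \<le> pmf \<mu> 1" using supp by (intro monotone_onD[OF anti]) auto
  then show ?thesis using pmf_positive[OF i] by linarith
qed

text \<open>Each of the at most \<open>e\<close> integers in the interval is at least \<open>m + 1\<close>, so by monotonicity its
  weight is at most that of \<open>m + 1\<close>.\<close>
lemma emeasure_interval_le_antimono:
  assumes anti: "antimono_on {1..} (pmf \<mu>)" and m: "enat m \<le> a"
  shows "emeasure (measure_pmf \<mu>) {x. a < enat x \<and> enat x \<le> a + enat e} \<le> ennreal (pmf \<mu> (Suc m) * e)"
proof (cases a)
  case (enat b)
  have "{x. a < enat x \<and> enat x \<le> a + enat e} = {b<..b + e}"
    by (auto simp: enat)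
  then have "emeasure \<mu> {x. a < enat x \<and> enat x \<le> a + enat e} = ennreal (\<Sum>x\<in>{b<..b + e}. pmf \<mu> x)"
    by (simp add: emeasure_measure_pmf_finite)
  also have "(\<Sum>x\<in>{b<..b + e}. pmf \<mu> x) \<le> (\<Sum>x\<in>{b<..b + e}. pmf \<mu> (Suc m))"
    using m enat by (intro sum_mono monotone_onD[OF anti]) auto
  finally show ?thesis by (simp add: ennreal_leI mult.commute)
qed simp

lemma sum_pmf_Suc_le_1: fixes \<mu> :: "nat pmf" shows "(\<Sum>m<N. pmf \<mu> (Suc m)) \<le> 1"
proof -
  have "(\<Sum>m<N. pmf \<mu> (Suc m)) = measure \<mu> (Suc ` {..<N})"
    by (simp add: measure_measure_pmf_finite sum.reindex)
  then show ?thesis by simp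
qed

text \<open>Each weight is repeated \<open>q\<close> times, so the sum is at most \<open>q\<close>.\<close>
lemma summable_pmf_div:
  fixes \<mu> :: "nat pmf"
  assumes "q > 0"
  shows "summable (\<lambda>n. pmf \<mu> (Suc (n div q)))"
proof (rule summableI_nonneg_bounded)
  fix N
  have block: "(\<Sum>i\<in>{m * q..<m * q + q}. pmf \<mu> (Suc (i div q))) = q * pmf \<mu> (Suc m)" for m
  proof -
    have "i div q = m" if "i \<in> {m * q..<m * q + q}" for i
      using that assms by (intro div_nat_eqI) (auto simp: ac_simps)
    then have "(\<Sum>i\<in>{m * q..<m * q + q}. pmf \<mu> (Suc (i div q))) = (\<Sum>i\<in>{m * q..<m * q + q}. pmf \<mu> (Suc m))"
      by (intro sum.cong) auto
    then show ?thesis by simp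
  qed
  have "(\<Sum>n<N. pmf \<mu> (Suc (n div q))) \<le> (\<Sum>n<N * q. pmf \<mu> (Suc (n div q)))"
    using assms by (intro sum_mono2) auto
  also have "\<dots> = (\<Sum>m<N. \<Sum>i\<in>{m * q..<m * q + q}. pmf \<mu> (Suc (i div q)))"
    by (rule sum.nat_group[symmetric])
  also have "\<dots> = q * (\<Sum>m<N. pmf \<mu> (Suc m))"
    by (simp add: block sum_distrib_left)
  also have "\<dots> \<le> real q * 1"
    by (intro mult_left_mono sum_pmf_Suc_le_1) simp
  finally show "(\<Sum>n<N. pmf \<mu> (Suc (n div q))) \<le> q" by simp
qed simp

section \<open>Independent draws\<close>

text \<open>Finitely many draws take only countably many values, hence measurability is no restriction on
  functionals of them.\<close>
lemma measurable_past_PiM: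
  "F \<in> PiM {1..n} (\<lambda>_::nat. count_space (UNIV :: nat set)) \<rightarrow>\<^sub>M count_space UNIV"
proof -
  have "PiM {1..n} (\<lambda>_. count_space (UNIV :: nat set)) = count_space ({1..n} \<rightarrow>\<^sub>E UNIV)"
    by (rule count_space_PiM_finite) auto
  then show ?thesis by simp
qed

locale iid_draws = prob_space M for M :: "'a measure" +
  fixes \<xi> :: "nat \<Rightarrow> 'a \<Rightarrow> nat" and \<mu> :: "nat pmf"
  assumes indep: "indep_vars (\<lambda>_. count_space UNIV) \<xi> {1..}"
    and law: "n \<ge> 1 \<Longrightarrow> distr M (count_space UNIV) (\<xi> n) = measure_pmf \<mu>"
begin

lemma measurable_draw: "n \<ge> 1 \<Longrightarrow> \<xi> n \<in> M \<rightarrow>\<^sub>M count_space UNIV"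
  using indep by (auto simp: indep_vars_def)

lemma indep_vars_draws_shift:
  "indep_vars (\<lambda>_. count_space UNIV) (\<lambda>n. \<xi> (n + m)) {n. 1 \<le> n + m}"
proof -
  have "indep_vars (\<lambda>n. PiM {n + m} (\<lambda>_. count_space UNIV))
      (\<lambda>n \<omega>. restrict (\<lambda>i. \<xi> i \<omega>) {n + m}) {n. 1 \<le> n + m}"
    by (rule indep_vars_restrict[OF indep]) (auto simp: disjoint_family_on_def)
  then have "indep_vars (\<lambda>_. count_space UNIV)
      (\<lambda>n \<omega>. restrict (\<lambda>i. \<xi> i \<omega>) {n + m} (n + m)) {n. 1 \<le> n + m}"
    by (rule indep_vars_compose2[where Y = "\<lambda>n f. f (n + m)"])
      (auto intro: measurable_component_singleton)
  then show ?thesis by simp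
qed

lemma iid_draws_shift: "iid_draws M (\<lambda>n. \<xi> (n + m)) \<mu>"
proof unfold_locales
  show "indep_vars (\<lambda>_. count_space UNIV) (\<lambda>n. \<xi> (n + m)) {1..}"
    by (rule indep_vars_subset[OF indep_vars_draws_shift]) auto
qed (simp add: law)

lemma measurable_past:
  assumes F: "\<And>x y. (\<And>i. i \<in> {1..n} \<Longrightarrow> x i = y i) \<Longrightarrow> F x = F y"
  shows "(\<lambda>\<omega>. F (\<lambda>i. \<xi> i \<omega>)) \<in> M \<rightarrow>\<^sub>M count_space UNIV"
proof -
  have "(\<lambda>\<omega>. \<lambda>i\<in>{1..n}. \<xi> i \<omega>) \<in> M \<rightarrow>\<^sub>M PiM {1..n} (\<lambda>_. count_space UNIV)"
    by (rule measurable_restrict) (simp add: measurable_draw)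
  then have "(\<lambda>\<omega>. F (\<lambda>i\<in>{1..n}. \<xi> i \<omega>)) \<in> M \<rightarrow>\<^sub>M count_space UNIV"
    by (rule measurable_compose[OF _ measurable_past_PiM])
  moreover have "F (\<lambda>i\<in>{1..n}. \<xi> i \<omega>) = F (\<lambda>i. \<xi> i \<omega>)" for \<omega>
    by (rule F) simp
  ultimately show ?thesis by simp
qed

lemma indep_past_next:
  fixes F :: "(nat \<Rightarrow> nat) \<Rightarrow> nat"
  assumes F: "\<And>x y. (\<And>i. i \<in> {1..n} \<Longrightarrow> x i = y i) \<Longrightarrow> F x = F y"
  shows "indep_var (count_space UNIV) (\<lambda>\<omega>. F (\<lambda>i. \<xi> i \<omega>)) (count_space UNIV) (\<xi> (Suc n))"
proof -
  have "(\<lambda>f. f (Suc n)) \<in> PiM {Suc n} (\<lambda>_. count_space (UNIV :: nat set)) \<rightarrow>\<^sub>M count_space UNIV"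
    by (rule measurable_component_singleton) simp
  then have "indep_var (count_space UNIV) (F \<circ> (\<lambda>\<omega>. \<lambda>i\<in>{1..n}. \<xi> i \<omega>))
      (count_space UNIV) ((\<lambda>f. f (Suc n)) \<circ> (\<lambda>\<omega>. \<lambda>i\<in>{Suc n}. \<xi> i \<omega>))"
    by (intro indep_var_compose[OF indep_var_restrict[OF indep] measurable_past_PiM]) auto
  moreover have "F \<circ> (\<lambda>\<omega>. \<lambda>i\<in>{1..n}. \<xi> i \<omega>) = (\<lambda>\<omega>. F (\<lambda>i. \<xi> i \<omega>))"
    unfolding comp_def by (intro ext F) simp
  ultimately show ?thesis by (simp add: comp_def)
qed

text \<open>Conditioning on the first \<open>n\<close> draws: the next draw is independent of any functional \<open>F\<close> of
  them. The values of \<open>F\<close> are encoded as natural numbers because the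
  independence of a pair is formulated for variables of a common type.\<close>
lemma emeasure_next_draw:
  fixes F :: "(nat \<Rightarrow> nat) \<Rightarrow> 'b::countable"
  assumes F: "\<And>x y. (\<And>i. i \<in> {1..n} \<Longrightarrow> x i = y i) \<Longrightarrow> F x = F y"
  shows "emeasure M {\<omega> \<in> space M. \<xi> (Suc n) \<omega> \<in> S (F (\<lambda>i. \<xi> i \<omega>))}
    = (\<integral>\<^sup>+\<omega>. emeasure \<mu> (S (F (\<lambda>i. \<xi> i \<omega>))) \<partial>M)"
proof -
  let ?N = "count_space UNIV :: nat measure"
  let ?U = "\<lambda>\<omega>. to_nat (F (\<lambda>i. \<xi> i \<omega>))" and ?T = "\<lambda>u. S (from_nat u)"
  let ?B = "{p. snd p \<in> ?T (fst p)}"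
  have C: "?N \<Otimes>\<^sub>M ?N = count_space UNIV"
    using pair_measure_countable[of "UNIV :: nat set" "UNIV :: nat set"] by simp
  have joint: "distr M ?N ?U \<Otimes>\<^sub>M measure_pmf \<mu> = distr M (?N \<Otimes>\<^sub>M ?N) (\<lambda>\<omega>. (?U \<omega>, \<xi> (Suc n) \<omega>))"
    and [measurable]: "?U \<in> M \<rightarrow>\<^sub>M ?N" "\<xi> (Suc n) \<in> M \<rightarrow>\<^sub>M ?N"
    using indep_past_next[of n "\<lambda>x. to_nat (F x)", OF arg_cong[where f = to_nat, OF F]] law[of "Suc n"]
    unfolding indep_var_distribution_eq by auto
  have B: "?B \<in> sets (?N \<Otimes>\<^sub>M ?N)" unfolding C by simp
  have "{\<omega> \<in> space M. \<xi> (Suc n) \<omega> \<in> ?T (?U \<omega>)} = (\<lambda>\<omega>. (?U \<omega>, \<xi> (Suc n) \<omega>)) -` ?B \<inter> space M"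
    by auto
  then have "emeasure M {\<omega> \<in> space M. \<xi> (Suc n) \<omega> \<in> ?T (?U \<omega>)}
      = emeasure (distr M ?N ?U \<Otimes>\<^sub>M measure_pmf \<mu>) ?B"
    unfolding joint by (simp add: emeasure_distr B)
  also have "\<dots> = (\<integral>\<^sup>+u. emeasure \<mu> (Pair u -` ?B) \<partial>distr M ?N ?U)"
  proof (rule measure_pmf.emeasure_pair_measure_alt)
    have "sets (distr M ?N ?U \<Otimes>\<^sub>M measure_pmf \<mu>) = sets (?N \<Otimes>\<^sub>M ?N)"
      by (intro sets_pair_measure_cong) auto
    then show "?B \<in> sets (distr M ?N ?U \<Otimes>\<^sub>M measure_pmf \<mu>)" using B by simp
  qed
  also have "\<dots> = (\<integral>\<^sup>+\<omega>. emeasure \<mu> (?T (?U \<omega>)) \<partial>M)"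
    by (subst nn_integral_distr) (auto simp: vimage_def)
  finally show ?thesis by simp
qed

lemma prob_few_ones_le:
  assumes "n > 0" "\<epsilon> \<ge> 0"
  shows "prob {\<omega> \<in> space M. real (ones (\<lambda>i. \<xi> i \<omega>) n) \<le> n * pmf \<mu> 1 - \<epsilon>} \<le> exp (- 2 * \<epsilon>\<^sup>2 / n)"
proof -
  let ?X = "\<lambda>i \<omega>. if \<xi> i \<omega> = 1 then 1 else (0::real)"
  have E: "expectation (?X i) = pmf \<mu> 1" if "i \<ge> 1" for i
  proof -
    have "expectation (?X i) = measure_pmf.expectation \<mu> (\<lambda>x. if x = 1 then 1 else (0::real))"
      unfolding law[OF that, symmetric]
      by (rule integral_distr[symmetric]) (use measurable_draw[OF that] in auto)
    also have "\<dots> = measure_pmf.expectation \<mu> (indicator {1})"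
      by (intro Bochner_Integration.integral_cong) (auto simp: indicator_def)
    also have "\<dots> = pmf \<mu> 1" by (simp add: pmf.rep_eq)
    finally show ?thesis .
  qed
  interpret H: Hoeffding_ineq M "{1..n}" ?X "\<lambda>_. 0" "\<lambda>_. 1" "real n * pmf \<mu> 1"
  proof unfold_locales
    show "indep_vars (\<lambda>_. borel) ?X {1..n}"
      by (rule indep_vars_compose2[OF indep_vars_subset[OF indep], where Y = "\<lambda>_ x. if x = 1 then 1 else 0"]) auto
    show "real n * pmf \<mu> 1 \<equiv> (\<Sum>i\<in>{1..n}. expectation (?X i))"
      using sum.cong[OF refl E, of "{1..n}"] by simp
  qed auto
  have "(\<Sum>i\<in>{1..n}. ?X i \<omega>) = real (ones (\<lambda>i. \<xi> i \<omega>) n)" for \<omega>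
    unfolding ones_def by (simp add: sum.If_cases Int_def)
  then show ?thesis
    using H.Hoeffding_ineq_le[OF assms(2)] assms(1) by simp
qed

text \<open>The threshold \<open>n div q + C\<close> eventually lies at least a quarter of the mean \<open>n \<mu>(1)\<close> below that
  mean, so Hoeffding's inequality bounds the probability by a geometric sequence.\<close>
lemma summable_prob_few_ones:
  assumes p: "pmf \<mu> 1 > 0" and q: "q > 0" "2 \<le> q * pmf \<mu> 1"
  shows "summable (\<lambda>n. prob {\<omega> \<in> space M. ones (\<lambda>i. \<xi> i \<omega>) n < n div q + C})"
proof (rule summable_comparison_test_ev)
  let ?p = "pmf \<mu> 1"
  let ?r = "exp (- (?p\<^sup>2 / 8))"
  show "summable (\<lambda>n. ?r ^ n)" using p by (intro summable_geometric) simp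
  have "\<forall>\<^sub>F n in sequentially. n \<ge> nat \<lceil>4 * C / ?p\<rceil> \<and> n > 0"
    by (intro eventually_conj eventually_ge_at_top eventually_gt_at_top)
  then show "\<forall>\<^sub>F n in sequentially.
      norm (prob {\<omega> \<in> space M. ones (\<lambda>i. \<xi> i \<omega>) n < n div q + C}) \<le> ?r ^ n"
  proof eventually_elim
    case (elim n)
    then have n: "n > 0" "4 * C \<le> n * ?p"
      using p by (auto simp: field_simps nat_le_iff ceiling_le_iff)
    have "real (n div q) \<le> n / q" by (rule of_nat_div_le_of_nat)
    also have "\<dots> \<le> n * ?p / 2" using q n by (simp add: field_simps)
    finally have thr: "real (n div q + C) \<le> n * ?p - n * ?p / 4" using n by simp
    have [measurable]: "(\<lambda>\<omega>. ones (\<lambda>i. \<xi> i \<omega>) n) \<in> M \<rightarrow>\<^sub>M count_space UNIV"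
      by (rule measurable_past[where n = n]) (rule ones_cong)
    have "prob {\<omega> \<in> space M. ones (\<lambda>i. \<xi> i \<omega>) n < n div q + C}
        \<le> prob {\<omega> \<in> space M. real (ones (\<lambda>i. \<xi> i \<omega>) n) \<le> n * ?p - n * ?p / 4}"
      using thr by (intro finite_measure_mono) (auto, measurable)
    also have "\<dots> \<le> exp (- 2 * (n * ?p / 4)\<^sup>2 / n)"
      using n by (intro prob_few_ones_le) auto
    also have "- 2 * (n * ?p / 4)\<^sup>2 / n = n * (- (?p\<^sup>2 / 8))"
      using n by (simp add: field_simps power2_eq_square)
    also have "exp (n * (- (?p\<^sup>2 / 8))) = ?r ^ n" by (rule exp_of_nat_mult)
    finally show ?case by simp
  qed
qed

end

section \<open>Boundedness of the excess\<close>

text \<open>A discrete Gronwall inequality: \<open>1 + a n \<le> exp (a n)\<close>.\<close>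
lemma prod_sum_recursion_bounded:
  fixes s a e :: "nat \<Rightarrow> real"
  assumes rec: "\<And>n. s (Suc n) = (1 + a n) * s n + e n"
    and nonneg: "\<And>n. a n \<ge> 0" "\<And>n. e n \<ge> 0" "s 0 \<ge> 0"
    and summable: "summable a" "summable e"
  shows "s n \<le> exp (suminf a) * (s 0 + suminf e)"
proof -
  have "s n \<le> exp (\<Sum>i<n. a i) * (s 0 + (\<Sum>i<n. e i))"
  proof (induction n)
    case (Suc n)
    let ?A = "exp (\<Sum>i<n. a i)" and ?E = "s 0 + (\<Sum>i<n. e i)"
    have E: "?E \<ge> 0" using nonneg by (simp add: sum_nonneg)
    have "1 \<le> exp (\<Sum>i<Suc n. a i)" using nonneg by (simp add: sum_nonneg add_nonneg_nonneg)
    moreover have "(1 + a n) * s n \<le> exp (a n) * (?A * ?E)"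
    proof -
      have "(1 + a n) * s n \<le> (1 + a n) * (?A * ?E)"
        using Suc.IH nonneg(1)[of n] by (intro mult_left_mono) auto
      also have "\<dots> \<le> exp (a n) * (?A * ?E)"
        using E exp_ge_add_one_self[of "a n"] by (intro mult_right_mono) auto
      finally show ?thesis .
    qed
    ultimately have "(1 + a n) * s n + e n \<le> exp (a n) * (?A * ?E) + exp (\<Sum>i<Suc n. a i) * e n"
      using nonneg(2)[of n] by (intro add_mono) (auto simp: mult_le_cancel_right1)
    then show ?case by (simp add: rec exp_add algebra_simps)
  qed simp
  also have "\<dots> \<le> exp (suminf a) * (s 0 + suminf e)"
    using nonneg summable by (intro mult_mono add_mono) (auto intro!: sum_le_suminf add_nonneg_nonneg sum_nonneg)
  finally show ?thesis .
qed

context iid_draws begin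

lemma measurable_excess [measurable]: "(\<lambda>\<omega>. excess X d (\<lambda>i. \<xi> i \<omega>) n k) \<in> M \<rightarrow>\<^sub>M count_space UNIV"
  by (rule measurable_past[where n = n]) (rule excess_cong)

lemma measurable_ones [measurable]: "(\<lambda>\<omega>. ones (\<lambda>i. \<xi> i \<omega>) n) \<in> M \<rightarrow>\<^sub>M count_space UNIV"
  by (rule measurable_past[where n = n]) (rule ones_cong)

text \<open>The excess at \<open>k\<close> grows when the next draw hits an interval of length \<open>excess (k - 1)\<close>. If the
  draws so far contain enough ones, this interval lies beyond \<open>n div q\<close>, which bounds the
  conditional probability; otherwise the trivial bound \<open>1\<close> is used.\<close>
lemma nn_integral_excess_Suc_le:
  assumes anti: "antimono_on {1..} (pmf \<mu>)"
    and growth: "\<And>x n k. k \<le> K \<Longrightarrow> enat (ones x n) \<le> balls_from (ibm X x n) k + enat C"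
    and k: "k \<le> K"
  shows "(\<integral>\<^sup>+\<omega>. real (excess X d (\<lambda>i. \<xi> i \<omega>) (Suc n) k) \<partial>M)
    \<le> (\<integral>\<^sup>+\<omega>. real (excess X d (\<lambda>i. \<xi> i \<omega>) n k) \<partial>M)
      + ennreal (pmf \<mu> (Suc (n div q))) * (\<integral>\<^sup>+\<omega>. real (excess X d (\<lambda>i. \<xi> i \<omega>) n (k - 1)) \<partial>M)
      + ennreal (prob {\<omega> \<in> space M. ones (\<lambda>i. \<xi> i \<omega>) n < n div q + C})"
proof -
  define D where "D = (\<lambda>n k \<omega>. excess X d (\<lambda>i. \<xi> i \<omega>) n k)"
  have [measurable]: "D n k \<in> M \<rightarrow>\<^sub>M count_space UNIV" for n k unfolding D_def by measurable
  define few where "few = {\<omega> \<in> space M. ones (\<lambda>i. \<xi> i \<omega>) n < n div q + C}"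
  have [measurable]: "few \<in> sets M" unfolding few_def by measurable
  define F where "F = (\<lambda>x. (balls_from (ibm X x n) (k - 1), excess X d x n (k - 1)))"
  define S where "S = (\<lambda>(a, e). {x. a < enat x \<and> enat x \<le> a + enat e})"
  \<comment> \<open>The event that the next draw increases the excess at \<open>k\<close>.\<close>
  define J where "J = {\<omega> \<in> space M. \<xi> (Suc n) \<omega> \<in> S (F (\<lambda>i. \<xi> i \<omega>))}"
  have F: "F x = F y" if "\<And>i. i \<in> {1..n} \<Longrightarrow> x i = y i" for x y
    unfolding F_def using ibm_cong[of n x y X] excess_cong[of n x y X d] that by simp
  have "real (D (Suc n) k \<omega>) = real (D n k \<omega>) + indicator J \<omega>" if "\<omega> \<in> space M" for \<omega>
    using that by (simp add: D_def J_def S_def F_def Let_def indicator_def)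
  then have "ennreal (real (D (Suc n) k \<omega>)) = ennreal (real (D n k \<omega>)) + (indicator J \<omega> :: ennreal)"
    if "\<omega> \<in> space M" for \<omega>
    using that by (simp flip: ennreal_indicator add: ennreal_plus)
  moreover have [measurable]: "J \<in> sets M"
  proof -
    have [measurable]: "(\<lambda>\<omega>. F (\<lambda>i. \<xi> i \<omega>)) \<in> M \<rightarrow>\<^sub>M count_space UNIV" by (rule measurable_past) (rule F)
    have [measurable]: "\<xi> (Suc n) \<in> M \<rightarrow>\<^sub>M count_space UNIV" by (rule measurable_draw) simp
    show ?thesis unfolding J_def by measurable
  qed
  ultimately have "(\<integral>\<^sup>+\<omega>. real (D (Suc n) k \<omega>) \<partial>M) = (\<integral>\<^sup>+\<omega>. real (D n k \<omega>) \<partial>M) + emeasure M J"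
    by (subst nn_integral_indicator[symmetric], simp, subst nn_integral_add[symmetric])
      (auto intro!: nn_integral_cong)
  also have "emeasure M J = (\<integral>\<^sup>+\<omega>. emeasure \<mu> (S (F (\<lambda>i. \<xi> i \<omega>))) \<partial>M)"
    unfolding J_def by (rule emeasure_next_draw) (rule F)
  also have "\<dots> \<le> (\<integral>\<^sup>+\<omega>. ennreal (pmf \<mu> (Suc (n div q))) * real (D n (k - 1) \<omega>) + indicator few \<omega> \<partial>M)"
  proof (rule nn_integral_mono)
    fix \<omega> assume \<omega>: "\<omega> \<in> space M"
    show "emeasure \<mu> (S (F (\<lambda>i. \<xi> i \<omega>)))
      \<le> ennreal (pmf \<mu> (Suc (n div q))) * real (D n (k - 1) \<omega>) + indicator few \<omega>"
    proof (cases "\<omega> \<in> few")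
      case True
      have "emeasure \<mu> (S (F (\<lambda>i. \<xi> i \<omega>))) \<le> 1" by (rule measure_pmf.emeasure_le_1)
      then show ?thesis using True by (simp add: add_increasing)
    next
      case False
      then have "enat (n div q + C) \<le> enat (ones (\<lambda>i. \<xi> i \<omega>) n)" using \<omega> by (simp add: few_def not_less)
      also have "\<dots> \<le> balls_from (ibm X (\<lambda>i. \<xi> i \<omega>) n) (k - 1) + enat C"
        using k by (intro growth) simp
      finally have "enat (n div q) \<le> balls_from (ibm X (\<lambda>i. \<xi> i \<omega>) n) (k - 1)"
        by (cases "balls_from (ibm X (\<lambda>i. \<xi> i \<omega>) n) (k - 1)") auto
      then show ?thesis
        using emeasure_interval_le_antimono[OF anti, of "n div q"] False
        by (simp add: S_def F_def D_def ennreal_mult)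
    qed
  qed
  also have "\<dots> = ennreal (pmf \<mu> (Suc (n div q))) * (\<integral>\<^sup>+\<omega>. real (D n (k - 1) \<omega>) \<partial>M) + emeasure M few"
    by (simp add: nn_integral_add nn_integral_cmult)
  finally show ?thesis
    by (simp add: D_def few_def emeasure_eq_measure add.assoc add_left_mono del: excess.simps)
qed

text \<open>The bound \<open>s n\<close> on the expected excess holds for all positions up to \<open>K\<close> at once, which is
  what makes the induction on \<open>n\<close> work although the excess at \<open>k\<close> feeds on the one at \<open>k - 1\<close>.
  Since the excess increases with \<open>n\<close>, a bound on its expectations makes its supremum integrable
  and hence almost surely finite.\<close>
lemma AE_excess_bounded:
  assumes X: "X \<in> configs" and d: "\<And>k. d k \<le> c"
    and anti: "antimono_on {1..} (pmf \<mu>)" and p: "pmf \<mu> 1 > 0"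
  shows "AE \<omega> in M. \<forall>k. \<exists>B. \<forall>n. excess X d (\<lambda>i. \<xi> i \<omega>) n k \<le> B"
  unfolding AE_all_countable
proof
  fix K
  obtain C where growth: "\<And>x n k. k \<le> K \<Longrightarrow> enat (ones x n) \<le> balls_from (ibm X x n) k + enat C"
    using ones_le_balls_from[OF X] by metis
  \<comment> \<open>This \<open>q\<close> makes \<open>n div q\<close> at most half of the mean number of ones among \<open>n\<close> draws.\<close>
  define q where "q = nat \<lceil>2 / pmf \<mu> 1\<rceil>"
  have "2 / pmf \<mu> 1 \<le> q" unfolding q_def by linarith
  then have q: "2 \<le> q * pmf \<mu> 1" using p by (simp add: field_simps)
  then have q0: "q > 0" by (cases q) auto
  define a where "a = (\<lambda>n. pmf \<mu> (Suc (n div q)))"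
  define e where "e = (\<lambda>n. prob {\<omega> \<in> space M. ones (\<lambda>i. \<xi> i \<omega>) n < n div q + C})"
  define s where "s = rec_nat (real c) (\<lambda>n t. (1 + a n) * t + e n)"
  have s: "s 0 = c" "s (Suc n) = (1 + a n) * s n + e n" for n by (simp_all add: s_def)
  have a0: "a n \<ge> 0" and e0: "e n \<ge> 0" for n by (simp_all add: a_def e_def)
  have s0: "s n \<ge> 0" for n by (induction n) (simp_all add: s a0 e0)
  let ?D = "\<lambda>n k \<omega>. ennreal (real (excess X d (\<lambda>i. \<xi> i \<omega>) n k))"
  have "(\<integral>\<^sup>+\<omega>. ?D n k \<omega> \<partial>M) \<le> ennreal (s n)" if "k \<le> K" for n k
    using that
  proof (induction n arbitrary: k)
    case 0
    have "(\<integral>\<^sup>+\<omega>. ?D 0 k \<omega> \<partial>M) = ennreal (d k)" by (simp add: emeasure_space_1)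
    then show ?case using d[of k] by (simp add: s)
  next
    case (Suc n)
    have "(\<integral>\<^sup>+\<omega>. ?D (Suc n) k \<omega> \<partial>M)
      \<le> (\<integral>\<^sup>+\<omega>. ?D n k \<omega> \<partial>M) + ennreal (a n) * (\<integral>\<^sup>+\<omega>. ?D n (k - 1) \<omega> \<partial>M) + ennreal (e n)"
      unfolding a_def e_def by (rule nn_integral_excess_Suc_le[OF anti growth Suc.prems])
    also have "\<dots> \<le> ennreal (s n) + ennreal (a n) * ennreal (s n) + ennreal (e n)"
      using Suc.prems by (intro add_mono mult_left_mono Suc.IH) auto
    also have "\<dots> = ennreal (s (Suc n))"
      using a0 e0 s0 by (simp add: s distrib_right flip: ennreal_mult ennreal_plus)
    finally show ?case .
  qed
  moreover have "s n \<le> exp (suminf a) * (s 0 + suminf e)" for n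
  proof (rule prod_sum_recursion_bounded)
    show "summable a" unfolding a_def by (rule summable_pmf_div[OF q0])
    show "summable e" unfolding e_def by (rule summable_prob_few_ones[OF p q0 q])
  qed (simp_all add: s a0 e0)
  ultimately have le: "(\<integral>\<^sup>+\<omega>. ?D n K \<omega> \<partial>M) \<le> ennreal (exp (suminf a) * (s 0 + suminf e))" for n
    by (meson ennreal_leI order_refl order_trans)
  have "(\<integral>\<^sup>+\<omega>. (SUP n. ?D n K \<omega>) \<partial>M) = (SUP n. \<integral>\<^sup>+\<omega>. ?D n K \<omega> \<partial>M)"
    by (rule nn_integral_monotone_convergence_SUP)
      (auto simp: incseq_def le_fun_def intro!: ennreal_leI incseqD[OF excess_mono])
  also have "\<dots> \<le> ennreal (exp (suminf a) * (s 0 + suminf e))" by (rule SUP_least) (rule le)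
  finally have "(\<integral>\<^sup>+\<omega>. (SUP n. ?D n K \<omega>) \<partial>M) \<noteq> \<infinity>" by (auto simp: top_unique)
  then have "AE \<omega> in M. (SUP n. ?D n K \<omega>) \<noteq> \<infinity>" by (intro nn_integral_PInf_AE) auto
  then show "AE \<omega> in M. \<exists>B. \<forall>n. excess X d (\<lambda>i. \<xi> i \<omega>) n K \<le> B"
  proof eventually_elim
    case (elim \<omega>)
    then obtain B where "(SUP n. ?D n K \<omega>) = ennreal B" "B \<ge> 0" by (cases "SUP n. ?D n K \<omega>") auto
    then have "ennreal (real (excess X d (\<lambda>i. \<xi> i \<omega>) n K)) \<le> ennreal B" for n
      by (metis SUP_upper UNIV_I)
    then have "real (excess X d (\<lambda>i. \<xi> i \<omega>) n K) \<le> B" for n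
      using \<open>B \<ge> 0\<close> by (simp add: ennreal_le_iff)
    then have "excess X d (\<lambda>i. \<xi> i \<omega>) n K \<le> nat \<lceil>B\<rceil>" for n
      by (smt (verit) le_nat_iff nat_le_real_less of_nat_ceiling of_nat_le_iff real_nat_ceiling_ge)
    then show ?case by blast
  qed
qed

end

section \<open>The zero-one law\<close>

lemma ibm_Suc_shift:
  "ibm X x (Suc n) = ibm (ibm_step (x (Suc 0)) X) (\<lambda>i. x (Suc i)) n"
  by (induction n) auto

lemma ibm_limit_shift:
  "ibm_limit X x k = ibm_limit (ibm_step (x (Suc 0)) X) (\<lambda>i. x (Suc i)) k"
  using LIMSEQ_Suc[OF ibm_tendsto_limit[of X x k]] ibm_tendsto_limit[of "ibm_step (x (Suc 0)) X"]
  unfolding ibm_Suc_shift by (rule LIMSEQ_unique)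

context iid_draws begin

text \<open>The exceptional null set does not depend on \<open>j\<close>, so that \<open>j\<close> may later be
  replaced by a random draw. This works because there are only countably many \<open>j\<close>.\<close>
lemma AE_limit_finite_step_iff:
  assumes X: "X \<in> configs"
    and anti: "antimono_on {1..} (pmf \<mu>)" and p: "pmf \<mu> 1 > 0"
  shows "AE \<omega> in M. \<forall>j. ibm_limit (ibm_step j X) (\<lambda>i. \<xi> i \<omega>) k < \<infinity> \<longleftrightarrow> ibm_limit X (\<lambda>i. \<xi> i \<omega>) k < \<infinity>"
  unfolding AE_all_countable
proof
  fix j
  define d where "d = (\<lambda>k. if 1 \<le> j \<and> enat j \<le> balls_from X (k - 1) then 1 else (0::nat))"
  have tail: "balls_from (ibm_step j X) k = balls_from X k + enat (d k)" for k
    by (simp add: balls_from_ibm_step[OF X] d_def one_enat_def flip: zero_enat_def)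
  have inf: "X k = \<infinity> \<longleftrightarrow> ibm_step j X k = \<infinity>"
    by (cases "X k") (auto simp: ibm_step_eq[OF X] one_enat_def)
  have "AE \<omega> in M. \<forall>k. \<exists>B. \<forall>n. excess X d (\<lambda>i. \<xi> i \<omega>) n k \<le> B"
    using AE_excess_bounded[OF X _ anti p, of d 1] by (simp add: d_def)
  then show "AE \<omega> in M. ibm_limit (ibm_step j X) (\<lambda>i. \<xi> i \<omega>) k < \<infinity>
      \<longleftrightarrow> ibm_limit X (\<lambda>i. \<xi> i \<omega>) k < \<infinity>"
    by eventually_elim
      (rule limit_finite_iff_of_bounded_excess[OF X ibm_step_in_configs[OF X] tail inf], blast)
qed

definition finite_after :: "config \<Rightarrow> int \<Rightarrow> nat \<Rightarrow> 'a set" where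
  "finite_after X k m = {\<omega> \<in> space M. ibm_limit X (\<lambda>i. \<xi> (i + m) \<omega>) k < \<infinity>}"

definition draw_events :: "nat \<Rightarrow> 'a set set" where
  "draw_events i = {\<xi> i -` A \<inter> space M | A. True}"

lemma sets_finite_after [measurable]: "finite_after X k m \<in> sets M"
  unfolding finite_after_def by (rule sets_ibm_limit_finite) (simp add: measurable_draw)

text \<open>Discarding one draw less amounts to starting the shifted model after one step, which almost surely
  does not affect finiteness.\<close>
lemma AE_finite_after_Suc:
  assumes X: "X \<in> configs"
    and anti: "antimono_on {1..} (pmf \<mu>)" and p: "pmf \<mu> 1 > 0"
  shows "AE \<omega> in M. \<omega> \<in> finite_after X k m \<longleftrightarrow> \<omega> \<in> finite_after X k (Suc m)"
proof -
  interpret S: iid_draws M "\<lambda>n. \<xi> (n + Suc m)" \<mu> by (rule iid_draws_shift)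
  show ?thesis
    using S.AE_limit_finite_step_iff[OF X anti p, of k]
  proof eventually_elim
    case (elim \<omega>)
    have "ibm_limit X (\<lambda>i. \<xi> (i + m) \<omega>) k
        = ibm_limit (ibm_step (\<xi> (Suc m) \<omega>) X) (\<lambda>i. \<xi> (i + Suc m) \<omega>) k"
      using ibm_limit_shift[of X "\<lambda>i. \<xi> (i + m) \<omega>" k] by simp
    then show ?case
      using elim by (simp add: finite_after_def)
  qed
qed

text \<open>The measurability of the limit event is applied to the space equipped with the
  \<open>\<sigma>\<close>-algebra generated by the late draws only.\<close>
lemma finite_after_in_tail:
  assumes "n \<le> m"
  shows "finite_after X k m \<in> sigma_sets (space M) (\<Union>i\<in>{n..}. draw_events (Suc i))"
proof -
  let ?G = "\<Union>i\<in>{n..}. draw_events (Suc i)"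
  let ?S = "sigma (space M) ?G"
  have G: "?G \<subseteq> Pow (space M)" by (auto simp: draw_events_def)
  have "\<xi> (i + m) \<in> ?S \<rightarrow>\<^sub>M count_space UNIV" if "i \<ge> 1" for i
  proof (rule measurableI)
    fix A :: "nat set"
    have "\<xi> (i + m) -` A \<inter> space M \<in> draw_events (Suc (i + m - 1))"
      using that by (auto simp: draw_events_def)
    moreover have "i + m - 1 \<in> {n..}" using that assms by auto
    ultimately have "\<xi> (i + m) -` A \<inter> space M \<in> ?G" by blast
    then show "\<xi> (i + m) -` A \<inter> space ?S \<in> sets ?S"
      using G by (simp add: sets_measure_of space_measure_of)
  qed simp
  then have "{\<omega> \<in> space ?S. ibm_limit X (\<lambda>i. \<xi> (i + m) \<omega>) k < \<infinity>} \<in> sets ?S"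
    by (rule sets_ibm_limit_finite)
  then show ?thesis
    using G by (simp add: finite_after_def sets_measure_of space_measure_of)
qed

lemma indep_sets_draw_events: "indep_sets (\<lambda>i. sigma_sets (space M) (draw_events (Suc i))) UNIV"
proof -
  have "indep_vars (\<lambda>_. count_space UNIV) (\<lambda>i. \<xi> (Suc i)) UNIV"
    using indep_vars_draws_shift[of 1] by simp
  then show ?thesis by (simp add: indep_vars_def draw_events_def)
qed

lemma prob_limit_finite_zero_one:
  assumes X: "X \<in> configs"
    and anti: "antimono_on {1..} (pmf \<mu>)" and p: "pmf \<mu> 1 > 0"
  shows "prob {\<omega> \<in> space M. ibm_limit X (\<lambda>n. \<xi> n \<omega>) k < \<infinity>} \<in> {0, 1}"
proof -
  \<comment> \<open>The limit superior of the events, a tail event.\<close>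
  define T where "T = (\<Inter>n. \<Union>m\<in>{n..}. finite_after X k m)"
  have "AE \<omega> in M. \<forall>m. \<omega> \<in> finite_after X k m \<longleftrightarrow> \<omega> \<in> finite_after X k (Suc m)"
    unfolding AE_all_countable using AE_finite_after_Suc[OF X anti p] by blast
  then have "AE \<omega> in M. \<omega> \<in> finite_after X k 0 \<longleftrightarrow> \<omega> \<in> T"
  proof eventually_elim
    case (elim \<omega>)
    have "\<omega> \<in> finite_after X k m \<longleftrightarrow> \<omega> \<in> finite_after X k 0" for m
      by (induction m) (use elim in auto)
    then show ?case by (auto simp: T_def)
  qed
  moreover have "T \<in> sets M" unfolding T_def by measurable
  ultimately have "prob (finite_after X k 0) = prob T"
    by (intro finite_measure_eq_AE) auto
  moreover have "prob T = 0 \<or> prob T = 1"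
  proof (rule kolmogorov_0_1_law[OF _ indep_sets_draw_events])
    show "sigma_algebra (space M) (sigma_sets (space M) (draw_events (Suc i)))" for i
      by (rule sigma_algebra_sigma_sets) (auto simp: draw_events_def)
    have draw_sub: "sigma_sets (space M) (draw_events (Suc i)) \<subseteq> Pow (space M)" for i
    proof
      fix A assume "A \<in> sigma_sets (space M) (draw_events (Suc i))"
      then have "A \<subseteq> space M" by (rule sigma_sets_into_sp[rotated]) (auto simp: draw_events_def)
      then show "A \<in> Pow (space M)" by simp
    qed
    let ?\<Sigma> = "\<lambda>n. sigma_sets (space M) (\<Union>i\<in>{n..}. sigma_sets (space M) (draw_events (Suc i)))"
    have "T \<in> ?\<Sigma> n" for n
    proof -
      interpret sigma_algebra "space M" "?\<Sigma> n"
        by (rule sigma_algebra_sigma_sets) (use draw_sub in blast)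
      have "finite_after X k m \<in> ?\<Sigma> n" if "n \<le> m" for m
      proof (rule subsetD[OF sigma_sets_subseteq finite_after_in_tail[OF that]])
        show "(\<Union>i\<in>{n..}. draw_events (Suc i))
            \<subseteq> (\<Union>i\<in>{n..}. sigma_sets (space M) (draw_events (Suc i)))"
          by (intro UN_mono subsetI sigma_sets.Basic) auto
      qed
      then have "(\<Union>m\<in>{n'..}. finite_after X k m) \<in> ?\<Sigma> n" if "n \<le> n'" for n'
        using that by (intro countable_UN' countableI_type image_subsetI) simp
      then have "(\<Inter>n'\<in>{n..}. \<Union>m\<in>{n'..}. finite_after X k m) \<in> ?\<Sigma> n"
        by (intro countable_INT' countableI_type image_subsetI) auto
      moreover have "(\<Inter>n'\<in>{n..}. \<Union>m\<in>{n'..}. finite_after X k m) = T"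
      proof (intro equalityI subsetI)
        fix \<omega> assume \<omega>: "\<omega> \<in> (\<Inter>n'\<in>{n..}. \<Union>m\<in>{n'..}. finite_after X k m)"
        have "\<omega> \<in> (\<Union>m\<in>{n'..}. finite_after X k m)" for n'
        proof -
          have "\<omega> \<in> (\<Union>m\<in>{max n n'..}. finite_after X k m)" using \<omega> by (rule INT_D) simp
          then show ?thesis by (rule subsetD[rotated]) (intro UN_mono, auto)
        qed
        then show "\<omega> \<in> T" unfolding T_def by blast
      qed (auto simp: T_def)
      ultimately show ?thesis by simp
    qed
    then show "T \<in> tail_events (\<lambda>i. sigma_sets (space M) (draw_events (Suc i)))"
      by (auto simp: tail_events_def)
  qed
  ultimately show ?thesis by (simp add: finite_after_def)
qed

end

theorem theorem1p3:
  fixes M :: "'a measure" and \<xi> :: "nat \<Rightarrow> 'a \<Rightarrow> nat"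
    and \<mu> :: "nat pmf" and X0 :: "int \<Rightarrow> enat"
  assumes "prob_space M"
    and "set_pmf \<mu> \<subseteq> {1..}"
    and "antimono_on {1..} (pmf \<mu>)"
    and "X0 \<in> configs"
    and "prob_space.indep_vars M (\<lambda>_. count_space UNIV) \<xi> {1..}"
    and "\<forall>n\<ge>1. distr M (count_space UNIV) (\<xi> n) = measure_pmf \<mu>"
  shows "\<forall>k::int. measure M {\<omega> \<in> space M. ibm_limit X0 (\<lambda>n. \<xi> n \<omega>) k < \<infinity>} \<in> {0, 1}"
proof -
  interpret iid_draws M \<xi> \<mu>
    using assms(1,5,6) by (simp add: iid_draws_def iid_draws_axioms_def)
  show ?thesis
    using prob_limit_finite_zero_one[OF assms(4,3) pmf_1_pos[OF assms(2,3)]] by blast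
qed

end
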